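(* Let $\lambda>1$ be a real number. The following hold. (i) If a basis $\mathcal{B}$ of an infinite-dimensional Banach space is reverse partially greedy (RPG), then $\mathcal{B}$ is $\lambda$-RPG2. (ii) There exist an infinite-dimensional Banach space $\mathbb{X}$ and an unconditional basis $\mathcal{B}$ of $\mathbb{X}$ such that $\mathcal{B}$ is $\lambda$-RPG2 but is not RPG.
   Context: $\mathbb{N}=\{1,2,\ldots\}$; Banach spaces are over $\mathbb{K}=\mathbb{R}$ or $\mathbb{C}$. A basis of an infinite-dimensional Banach space $\mathbb{X}$ is a sequence $\mathcal{B}=(e_n)_{n=1}^\infty$ in $\mathbb{X}$ such that: (i) the linear span of $(e_n)_n$ is norm-dense in $\mathbb{X}$; (ii) there are biorthogonal functionals $(e_n^* )_n\subset\mathbb{X}^*$, i.e. $e_n^*(e_m)=\delta_{n,m}$; (iii) there are $c_1,c_2>0$ with $c_1\leqslant\|e_n\|,\|e_n^*\|\leqslant c_2$ for all $n$. (Totality of $(e_n^* )_n$ and the Schauder property are not assumed.) For a finite set $A\subset\mathbb{N}$, $P_A(x)=\sum_{n\in A}e_n^*(x)e_n$. A finite set $\Lambda\subset\mathbb{N}$ is a greedy set of $x$ if $\min_{n\in\Lambda}|e_n^*(x)|\geqslant\max_{n\notin\Lambda}|e_n^*(x)|$; $G(x,m)$ is the set of all greedy sets of $x$ of cardinality $m$. For sets $A,B\subset\mathbb{N}$, $A>B$ means $a>b$ for all $a\in A$, $b\in B$ (vacuously true if one of them is empty), and similarly for $<,\geqslant,\leqslant$; a number $k$ is treated as $\{k\}$.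 $\mathcal{B}$ is RPG if there is $\mathbf{C}\geqslant 1$ such that for all $x\in\mathbb{X}$, $m\in\mathbb{N}$, $\Lambda\in G(x,m)$, $$\|x-P_\Lambda(x)\|\leqslant\mathbf{C}\inf\{\|x-P_A(x)\|: A\subset\mathbb{N},\ |A|\leqslant m,\ A>\Lambda\}.$$ An interval is a set of consecutive positive integers. For $A\subset\mathbb{N}$, $$\check{\sigma}^{A}_m(x)=\inf\{\|x-P_I(x)\|:\ \text{either } I=\emptyset,\ \text{or } I \text{ is an interval with } A\leqslant\max I,\ |I|\leqslant m\}.$$ For $\lambda\geqslant1$, $\mathcal{B}$ is $\lambda$-RPG2 if there is $\mathbf{C}\geqslant1$ such that $\|x-P_\Lambda(x)\|\leqslant\mathbf{C}\,\check{\sigma}^{\Lambda}_m(x)$ for all $x\in\mathbb{X}$, $m\in\mathbb{N}$, $\Lambda\in G(x,\lceil\lambda m\rceil)$. *)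

theory Defs
  imports Complex_Main "HOL-Library.Function_Algebras"
begin

(* The scalar field K is a type 'k of sort {real_normed_field, banach}. The norm of a
   real_normed_field is multiplicative, so by the Gelfand-Mazur theorem every such type is
   isometrically isomorphic to real or to complex; both are instances.

   A Banach space over K is a subspace V of an ambient K-vector space together with a complete
   norm N on V. Taking V = UNIV gives a Banach space whose points are all elements of a type;
   working with a carrier makes it possible to quantify existentially over Banach spaces. *)

locale banach_space_on = vector_space scale
  for scale :: "'k::{real_normed_field,banach} \<Rightarrow> 'v::ab_group_add \<Rightarrow> 'v" +
  fixes V :: "'v set" and N :: "'v \<Rightarrow> real"
  assumes subspace_V: "subspace V"
    and N_eq_0_iff: "\<And>x. x \<in> V \<Longrightarrow> N x = 0 \<longleftrightarrow> x = 0"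
    and N_triangle: "\<And>x y. x \<in> V \<Longrightarrow> y \<in> V \<Longrightarrow> N (x + y) \<le> N x + N y"
    and N_scale: "\<And>c x. x \<in> V \<Longrightarrow> N (scale c x) = norm c * N x"
    and complete_V: "\<And>X :: nat \<Rightarrow> 'v. (\<forall>n. X n \<in> V) \<Longrightarrow>
          (\<forall>\<epsilon>>0. \<exists>M. \<forall>m\<ge>M. \<forall>n\<ge>M. N (X m - X n) < \<epsilon>) \<Longrightarrow>
          (\<exists>L\<in>V. (\<lambda>n. N (X n - L)) \<longlonglongrightarrow> 0)"

definition infinite_dimensional ::
    "('k::field \<Rightarrow> 'v::ab_group_add \<Rightarrow> 'v) \<Rightarrow> 'v set \<Rightarrow> bool" where
  "infinite_dimensional scale V \<longleftrightarrow>
     \<not> (\<exists>B. finite B \<and> B \<subseteq> V \<and> V \<subseteq> module.span scale B)"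

(* Elements of the dual of (V, N): only the values on V matter. *)
definition bounded_functional ::
    "('k::real_normed_field \<Rightarrow> 'v::ab_group_add \<Rightarrow> 'v) \<Rightarrow> 'v set \<Rightarrow> ('v \<Rightarrow> real) \<Rightarrow> ('v \<Rightarrow> 'k) \<Rightarrow> bool" where
  "bounded_functional scale V N \<phi> \<longleftrightarrow>
     (\<forall>x\<in>V. \<forall>y\<in>V. \<phi> (x + y) = \<phi> x + \<phi> y) \<and>
     (\<forall>c. \<forall>x\<in>V. \<phi> (scale c x) = c * \<phi> x) \<and>
     (\<exists>M. \<forall>x\<in>V. norm (\<phi> x) \<le> M * N x)"

definition dual_norm :: "'v set \<Rightarrow> ('v \<Rightarrow> real) \<Rightarrow> ('v \<Rightarrow> 'k::real_normed_field) \<Rightarrow> real" where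
  "dual_norm V N \<phi> = (SUP x\<in>{x\<in>V. N x \<le> 1}. norm (\<phi> x))"

(* Sequences are indexed by nat, i.e. shifted by one with respect to 1, 2, 3, ...; the notions
   below use only the order and the successor structure of the indices and cardinalities.

   f n stands for the n-th biorthogonal functional. By density of the span, the sequence f is
   determined on V by e, so passing it along with e is no additional choice. *)
definition is_basis ::
    "('k::real_normed_field \<Rightarrow> 'v::ab_group_add \<Rightarrow> 'v) \<Rightarrow> 'v set \<Rightarrow> ('v \<Rightarrow> real) \<Rightarrow>
     (nat \<Rightarrow> 'v) \<Rightarrow> (nat \<Rightarrow> 'v \<Rightarrow> 'k) \<Rightarrow> bool" where
  "is_basis scale V N e f \<longleftrightarrow>
     (\<forall>n. e n \<in> V) \<and>
     (\<forall>x\<in>V. \<forall>\<epsilon>>0. \<exists>y\<in>module.span scale (range e). N (x - y) < \<epsilon>) \<and>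
     (\<forall>n. bounded_functional scale V N (f n)) \<and>
     (\<forall>n m. f n (e m) = (if n = m then 1 else 0)) \<and>
     (\<exists>c1 c2. c1 > 0 \<and> c2 > 0 \<and>
        (\<forall>n. c1 \<le> N (e n) \<and> N (e n) \<le> c2 \<and> c1 \<le> dual_norm V N (f n) \<and> dual_norm V N (f n) \<le> c2))"

definition proj ::
    "('k \<Rightarrow> 'v::ab_group_add \<Rightarrow> 'v) \<Rightarrow> (nat \<Rightarrow> 'v) \<Rightarrow> (nat \<Rightarrow> 'v \<Rightarrow> 'k) \<Rightarrow> nat set \<Rightarrow> 'v \<Rightarrow> 'v" where
  "proj scale e f A x = (\<Sum>n\<in>A. scale (f n x) (e n))"

(* For every x, the series of the f n x * e n converges unconditionally to x,
   i.e. every rearrangement of it converges to x. *)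
definition unconditional ::
    "('k::real_normed_field \<Rightarrow> 'v::ab_group_add \<Rightarrow> 'v) \<Rightarrow> 'v set \<Rightarrow> ('v \<Rightarrow> real) \<Rightarrow>
     (nat \<Rightarrow> 'v) \<Rightarrow> (nat \<Rightarrow> 'v \<Rightarrow> 'k) \<Rightarrow> bool" where
  "unconditional scale V N e f \<longleftrightarrow>
     (\<forall>x\<in>V. \<forall>\<pi>. bij \<pi> \<longrightarrow>
        (\<lambda>n. N (x - (\<Sum>k<n. scale (f (\<pi> k) x) (e (\<pi> k))))) \<longlonglongrightarrow> 0)"

definition greedy_sets :: "(nat \<Rightarrow> 'v \<Rightarrow> 'k::real_normed_field) \<Rightarrow> 'v \<Rightarrow> nat \<Rightarrow> nat set set" where
  "greedy_sets f x m =
     {\<Lambda>. finite \<Lambda> \<and> card \<Lambda> = m \<and> (\<forall>n\<in>\<Lambda>. \<forall>k. k \<notin> \<Lambda> \<longrightarrow> norm (f n x) \<ge> norm (f k x))}"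

definition RPG ::
    "('k::real_normed_field \<Rightarrow> 'v::ab_group_add \<Rightarrow> 'v) \<Rightarrow> 'v set \<Rightarrow> ('v \<Rightarrow> real) \<Rightarrow>
     (nat \<Rightarrow> 'v) \<Rightarrow> (nat \<Rightarrow> 'v \<Rightarrow> 'k) \<Rightarrow> bool" where
  "RPG scale V N e f \<longleftrightarrow>
     (\<exists>C\<ge>1. \<forall>x\<in>V. \<forall>m\<ge>1. \<forall>\<Lambda>\<in>greedy_sets f x m.
        N (x - proj scale e f \<Lambda> x) \<le>
        C * Inf {N (x - proj scale e f A x) | A.
                   finite A \<and> card A \<le> m \<and> (\<forall>a\<in>A. \<forall>b\<in>\<Lambda>. a > b)})"

(* The infimum over the empty set and the intervals I of at most m elements with A \<le> max I. *)
definition sigma_check ::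
    "('k::real_normed_field \<Rightarrow> 'v::ab_group_add \<Rightarrow> 'v) \<Rightarrow> ('v \<Rightarrow> real) \<Rightarrow>
     (nat \<Rightarrow> 'v) \<Rightarrow> (nat \<Rightarrow> 'v \<Rightarrow> 'k) \<Rightarrow> nat set \<Rightarrow> nat \<Rightarrow> 'v \<Rightarrow> real" where
  "sigma_check scale N e f A m x =
     Inf {N (x - proj scale e f I x) | I.
            I = {} \<or>
            ((\<exists>i j. i \<le> j \<and> I = {i..j}) \<and> (\<forall>a\<in>A. a \<le> Max I) \<and> card I \<le> m)}"

definition RPG2 ::
    "real \<Rightarrow> ('k::real_normed_field \<Rightarrow> 'v::ab_group_add \<Rightarrow> 'v) \<Rightarrow> 'v set \<Rightarrow> ('v \<Rightarrow> real) \<Rightarrow>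
     (nat \<Rightarrow> 'v) \<Rightarrow> (nat \<Rightarrow> 'v \<Rightarrow> 'k) \<Rightarrow> bool" where
  "RPG2 lam scale V N e f \<longleftrightarrow>
     (\<exists>C\<ge>1. \<forall>x\<in>V. \<forall>m\<ge>1. \<forall>\<Lambda>\<in>greedy_sets f x (nat \<lceil>lam * real m\<rceil>).
        N (x - proj scale e f \<Lambda> x) \<le> C * sigma_check scale N e f \<Lambda> m x)"

end

theory Submission
  imports Defs
begin

text \<open>If \<open>\<Lambda>\<close> has \<open>\<lceil>lam * m\<rceil>\<close> elements and ends no later than an interval \<open>I\<close> of at most \<open>m\<close> points, then
  \<open>B = \<Lambda> - I\<close> lies to the left of \<open>I\<close> and has at least \<open>(lam - 1) * m\<close> elements. Both halves of the
  theorem rest on this count (\<open>greedy_set_left_of_interval\<close>), for opposite purposes.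

  For the implication, let \<open>y = x - P I x\<close>. The vector \<open>x - P \<Lambda> x\<close> arises from \<open>y\<close> by removing \<open>B\<close> and
  restoring \<open>I - \<Lambda>\<close>. Since \<open>B\<close> is greedy for \<open>y\<close>, removing it is harmless. The set \<open>I - \<Lambda>\<close> is cut into
  boundedly many blocks no larger than \<open>B\<close>, the number of blocks depending on \<open>lam\<close> only; each block
  lies to the right of \<open>B\<close> and carries coefficients no larger than those on \<open>B\<close>, so the RPG property,
  applied to \<open>y\<close> with that block restored, bounds the block by \<open>y\<close> (\<open>N_residual_le_blocks\<close>).

  The counterexample to the converse exploits that RPG2 tests intervals only. Take the null sequences
  that are absolutely summable along the powers of two, with the supremum norm plus the sum of the
  moduli at the powers of two. RPG fails (\<open>not_RPG_pow2_space\<close>), because a set of powers of two far to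
  the right has a much larger norm than an equally large set avoiding them. An interval \<open>I\<close> as above,
  however, has at least \<open>(lam - 1) * m\<close> points to its left, so its endpoints have bounded ratio and it
  contains boundedly many powers of two; for the purpose of RPG2 the norm behaves like the supremum
  norm (\<open>RPG2_pow2_space\<close>).\<close>

section \<open>The part of a greedy set to the left of an interval\<close>

lemma greedy_set_left_of_interval:
  fixes \<Lambda> :: "nat set"
  assumes "finite \<Lambda>" "card \<Lambda> = nat \<lceil>lam * real m\<rceil>" "lam > 1" "m \<ge> 1"
    and "i \<le> j" "card {i..j} \<le> m" "\<forall>a\<in>\<Lambda>. a \<le> Max {i..j}"
  shows "\<Lambda> - {i..j} \<subseteq> {..<i}" "(lam - 1) * real m \<le> real (card (\<Lambda> - {i..j}))"
    "\<Lambda> - {i..j} \<noteq> {}"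
proof -
  have "Max {i..j} = j"
    using assms(5) by (intro Max_eqI) auto
  then show "\<Lambda> - {i..j} \<subseteq> {..<i}"
    using assms(7) by auto
  have "lam * real m \<le> real (card \<Lambda>)"
    unfolding assms(2) by linarith
  moreover have "card \<Lambda> - card {i..j} \<le> card (\<Lambda> - {i..j})"
    by (rule diff_card_le_card_Diff) simp
  ultimately show le: "(lam - 1) * real m \<le> real (card (\<Lambda> - {i..j}))"
    using assms(6) by (simp add: algebra_simps)
  have "(lam - 1) * real m > 0"
    using assms by simp
  with le show "\<Lambda> - {i..j} \<noteq> {}"
    by (metis card.empty not_less of_nat_0)
qed

section \<open>Reverse partially greedy bases are RPG2 for every parameter above one\<close>

locale banach_basis = banach_space_on scale V N
  for scale :: "'k::{real_normed_field,banach} \<Rightarrow> 'v::ab_group_add \<Rightarrow> 'v" and V N +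
  fixes e :: "nat \<Rightarrow> 'v" and f :: "nat \<Rightarrow> 'v \<Rightarrow> 'k"
  assumes basis: "is_basis scale V N e f"
begin

abbreviation P :: "nat set \<Rightarrow> 'v \<Rightarrow> 'v" where
  "P \<equiv> proj scale e f"

lemma N_minus: "x \<in> V \<Longrightarrow> N (- x) = N x"
  using N_scale[of x "-1"] by (simp add: scale_minus_left)

lemma N_triangle_diff: "x \<in> V \<Longrightarrow> y \<in> V \<Longrightarrow> N (x - y) \<le> N x + N y"
  using N_triangle[of x "- y"] N_minus subspace_neg[OF subspace_V] by simp

lemma N_nonneg: "x \<in> V \<Longrightarrow> 0 \<le> N x"
  using N_triangle_diff[of x x] N_eq_0_iff[of 0] subspace_0[OF subspace_V] by simp

lemma f_add: "x \<in> V \<Longrightarrow> y \<in> V \<Longrightarrow> f n (x + y) = f n x + f n y"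
  and f_scale: "x \<in> V \<Longrightarrow> f n (scale c x) = c * f n x"
  and e_in_V: "e n \<in> V"
  and f_e: "f n (e m) = (if n = m then 1 else 0)"
  using basis by (simp_all add: is_basis_def bounded_functional_def)

lemma P_in_V: "P A x \<in> V"
  unfolding proj_def by (intro subspace_sum subspace_V subspace_scale e_in_V)

lemma residual_in_V: "x \<in> V \<Longrightarrow> x - P A x \<in> V"
  by (intro subspace_diff subspace_V P_in_V)

lemma f_P: "finite A \<Longrightarrow> f n (P A x) = (if n \<in> A then f n x else 0)"
proof (induction A rule: finite_induct)
  case empty
  show ?case
    using f_scale[of 0 n 0] subspace_0[OF subspace_V] by (simp add: proj_def)
next
  case (insert a A)
  have "P (insert a A) x = scale (f a x) (e a) + P A x"
    using insert by (simp add: proj_def)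
  then show ?case
    using insert by (auto simp: f_add P_in_V subspace_scale[OF subspace_V] e_in_V f_scale f_e)
qed

lemma f_residual:
  assumes "x \<in> V" "finite A"
  shows "f n (x - P A x) = (if n \<in> A then 0 else f n x)"
  using f_add[OF residual_in_V[OF assms(1), of A] P_in_V[of A x], of n] f_P[OF assms(2), of n x]
  by (auto simp: algebra_simps)

lemma P_Un_disjoint: "finite A \<Longrightarrow> finite B \<Longrightarrow> A \<inter> B = {} \<Longrightarrow> P (A \<union> B) x = P A x + P B x"
  by (simp add: proj_def sum.union_disjoint)

lemma residual_residual:
  assumes "x \<in> V" "finite A" "finite B" "A \<inter> B = {}"
  shows "(x - P A x) - P B (x - P A x) = x - P (A \<union> B) x"
proof -
  have "P B (x - P A x) = P B x"
    unfolding proj_def[of scale e f B] using assms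
    by (intro sum.cong refl arg_cong2[where f = scale]) (auto simp: f_residual)
  then show ?thesis
    using assms by (simp add: P_Un_disjoint algebra_simps)
qed

lemma N_P_le_blocks:
  assumes "finite E" "card E \<le> k * b" "\<And>D. D \<subseteq> E \<Longrightarrow> card D \<le> b \<Longrightarrow> N (P D x) \<le> M"
  shows "N (P E x) \<le> real k * M"
  using assms
proof (induction k arbitrary: E)
  case 0
  then show ?case
    using N_eq_0_iff[of 0] subspace_0[OF subspace_V] by (simp add: proj_def)
next
  case (Suc k)
  obtain D where D: "D \<subseteq> E" "card D = min b (card E)"
    using obtain_subset_with_card_n[of "min b (card E)" E] by auto
  have fin: "finite D" "finite (E - D)"
    using D Suc.prems(1) finite_subset by auto
  have "card (E - D) \<le> k * b"
    using D Suc.prems(2) fin by (simp add: card_Diff_subset)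
  then have "N (P (E - D) x) \<le> real k * M"
    using Suc.prems(3) fin by (intro Suc.IH) auto
  moreover have "N (P D x) \<le> M"
    using D Suc.prems(3) by simp
  moreover have "P E x = P D x + P (E - D) x"
    using P_Un_disjoint[of D "E - D" x] D(1) fin by (simp add: Un_absorb1)
  ultimately show ?case
    using N_triangle[of "P D x" "P (E - D) x"] P_in_V by (simp add: algebra_simps)
qed

lemma RPG_bound:
  assumes "RPG scale V N e f"
  obtains C where "C \<ge> 1"
    "\<And>x \<Lambda> A. x \<in> V \<Longrightarrow> \<Lambda> \<in> greedy_sets f x (card \<Lambda>) \<Longrightarrow> \<Lambda> \<noteq> {} \<Longrightarrow> finite A \<Longrightarrow> card A \<le> card \<Lambda> \<Longrightarrow>
       (\<forall>a\<in>A. \<forall>b\<in>\<Lambda>. a > b) \<Longrightarrow> N (x - P \<Lambda> x) \<le> C * N (x - P A x)"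
proof -
  obtain C where C: "C \<ge> 1" "\<And>x m \<Lambda>. x \<in> V \<Longrightarrow> m \<ge> 1 \<Longrightarrow> \<Lambda> \<in> greedy_sets f x m \<Longrightarrow>
      N (x - P \<Lambda> x) \<le> C * Inf {N (x - P A x) | A.
         finite A \<and> card A \<le> m \<and> (\<forall>a\<in>A. \<forall>b\<in>\<Lambda>. a > b)}"
    using assms unfolding RPG_def by blast
  show thesis
  proof (rule that[OF C(1)])
    fix x \<Lambda> A
    assume x: "x \<in> V" and \<Lambda>: "\<Lambda> \<in> greedy_sets f x (card \<Lambda>)" "\<Lambda> \<noteq> {}"
      and A: "finite A" "card A \<le> card \<Lambda>" "\<forall>a\<in>A. \<forall>b\<in>\<Lambda>. a > b"
    let ?S = "{N (x - P A x) | A. finite A \<and> card A \<le> card \<Lambda> \<and> (\<forall>a\<in>A. \<forall>b\<in>\<Lambda>. a > b)}"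
    have "Inf ?S \<le> N (x - P A x)"
      using A x by (intro cInf_lower bdd_belowI[of _ 0]) (auto intro: N_nonneg residual_in_V)
    moreover have "card \<Lambda> \<ge> 1"
      using \<Lambda> by (simp add: greedy_sets_def Suc_le_eq card_gt_0_iff)
    ultimately show "N (x - P \<Lambda> x) \<le> C * N (x - P A x)"
      using C(1) C(2)[OF x _ \<Lambda>(1)] by (smt (verit) mult_left_mono)
  qed
qed

text \<open>Write \<open>y = x - P I x\<close> and let \<open>D\<close> be a block of \<open>I - \<Lambda>\<close> no larger than \<open>B = \<Lambda> - I\<close>. In the vector
  \<open>y + P D x\<close> the set \<open>B\<close> is still greedy and lies to the left of \<open>D\<close>, so the hypothesis compares the
  removal of \<open>B\<close> with the removal of \<open>D\<close>, which leaves exactly \<open>y\<close>. Taking also \<open>D = {}\<close> and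
  subtracting, the block itself is controlled by \<open>y\<close>.\<close>

lemma N_residual_le_blocks:
  assumes RPG: "\<And>x \<Lambda> A. x \<in> V \<Longrightarrow> \<Lambda> \<in> greedy_sets f x (card \<Lambda>) \<Longrightarrow> \<Lambda> \<noteq> {} \<Longrightarrow> finite A \<Longrightarrow>
       card A \<le> card \<Lambda> \<Longrightarrow> (\<forall>a\<in>A. \<forall>b\<in>\<Lambda>. a > b) \<Longrightarrow> N (x - P \<Lambda> x) \<le> C * N (x - P A x)"
    and x: "x \<in> V" and \<Lambda>: "\<Lambda> \<in> greedy_sets f x n" and I: "finite I"
    and left: "\<forall>a\<in>I. \<forall>b\<in>\<Lambda> - I. a > b" and ne: "\<Lambda> - I \<noteq> {}"
    and card: "card (I - \<Lambda>) \<le> k * card (\<Lambda> - I)"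
  shows "N (x - P \<Lambda> x) \<le> (1 + 2 * real k) * C * N (x - P I x)"
proof -
  define B where "B = \<Lambda> - I"
  have fin: "finite \<Lambda>" "finite B"
    using \<Lambda> by (auto simp: greedy_sets_def B_def)
  (* z is y with the block D restored. *)
  have residual_le: "N (x - P (I - D \<union> B) x) \<le> C * N (x - P I x)"
    if D: "D \<subseteq> I - \<Lambda>" "card D \<le> card B" for D
  proof -
    define z where "z = x - P (I - D) x"
    have zV: "z \<in> V"
      unfolding z_def by (rule residual_in_V[OF x])
    have fz: "f n z = (if n \<in> I - D then 0 else f n x)" for n
      unfolding z_def using I by (intro f_residual x) auto
    have finD: "finite D"
      using D I finite_subset by blast
    have "B \<in> greedy_sets f z (card B)"
      using \<Lambda> D fin by (auto simp: greedy_sets_def fz B_def)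
    moreover have "\<forall>a\<in>D. \<forall>b\<in>B. a > b"
      using left D by (auto simp: B_def)
    ultimately have "N (z - P B z) \<le> C * N (z - P D z)"
      using RPG[OF zV _ _ finD] ne D by (simp add: B_def)
    moreover have "z - P B z = x - P (I - D \<union> B) x"
      unfolding z_def by (rule residual_residual) (use x I fin in \<open>auto simp: B_def\<close>)
    moreover have "z - P D z = x - P I x"
    proof -
      have "I - D \<union> D = I"
        using D by auto
      then show ?thesis
        unfolding z_def using residual_residual[of x "I - D" D] x I finD by auto
    qed
    ultimately show ?thesis
      by simp
  qed
  have all: "N (x - P (I \<union> B) x) \<le> C * N (x - P I x)"
    using residual_le[of "{}"] by simp
  have "N (P (I - \<Lambda>) x) \<le> real k * (2 * (C * N (x - P I x)))"
  proof (rule N_P_le_blocks[where b = "card B"])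
    fix D assume D: "D \<subseteq> I - \<Lambda>" "card D \<le> card B"
    have "finite D"
      using D I finite_subset by blast
    then have "P (I - D \<union> B \<union> D) x = P (I - D \<union> B) x + P D x"
      using D I fin by (intro P_Un_disjoint) (auto simp: B_def)
    moreover have "I - D \<union> B \<union> D = I \<union> B"
      using D by auto
    ultimately have "P D x = (x - P (I - D \<union> B) x) - (x - P (I \<union> B) x)"
      by simp
    then show "N (P D x) \<le> 2 * (C * N (x - P I x))"
      using N_triangle_diff[OF residual_in_V[OF x, of "I - D \<union> B"] residual_in_V[OF x, of "I \<union> B"]]
        residual_le[OF D] all by simp
  qed (use I card in \<open>auto simp: B_def\<close>)
  moreover have "x - P \<Lambda> x = (x - P (I \<union> B) x) + P (I - \<Lambda>) x"
  proof -
    have "I \<union> B = \<Lambda> \<union> (I - \<Lambda>)"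
      by (auto simp: B_def)
    then show ?thesis
      using P_Un_disjoint[of \<Lambda> "I - \<Lambda>" x] fin I by auto
  qed
  ultimately show ?thesis
    using N_triangle[OF residual_in_V[OF x, of "I \<union> B"] P_in_V[of "I - \<Lambda>" x]] all
    by (simp add: algebra_simps)
qed

theorem RPG_imp_RPG2:
  assumes "RPG scale V N e f" "lam > 1"
  shows "RPG2 lam scale V N e f"
proof -
  obtain C where C: "C \<ge> 1"
    and RPG: "\<And>x \<Lambda> A. x \<in> V \<Longrightarrow> \<Lambda> \<in> greedy_sets f x (card \<Lambda>) \<Longrightarrow> \<Lambda> \<noteq> {} \<Longrightarrow> finite A \<Longrightarrow>
       card A \<le> card \<Lambda> \<Longrightarrow> (\<forall>a\<in>A. \<forall>b\<in>\<Lambda>. a > b) \<Longrightarrow> N (x - P \<Lambda> x) \<le> C * N (x - P A x)"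
    using RPG_bound[OF assms(1)] by metis
  (* At most m points of I are restored and B has at least (lam - 1) * m elements. *)
  define k where "k = nat \<lceil>1 / (lam - 1)\<rceil>"
  define K where "K = (1 + 2 * real k) * C"
  have "C \<le> K"
    using C by (simp add: K_def algebra_simps)
  show ?thesis
    unfolding RPG2_def
  proof (intro exI conjI ballI allI impI)
    show "K \<ge> 1"
      using C \<open>C \<le> K\<close> by linarith
    fix x m \<Lambda>
    assume x: "x \<in> V" and m: "1 \<le> m" and \<Lambda>: "\<Lambda> \<in> greedy_sets f x (nat \<lceil>lam * real m\<rceil>)"
    have \<Lambda>': "finite \<Lambda>" "card \<Lambda> = nat \<lceil>lam * real m\<rceil>" "\<Lambda> \<in> greedy_sets f x (card \<Lambda>)"
      using \<Lambda> by (auto simp: greedy_sets_def)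
    have "lam * real m > 0"
      using assms(2) m by simp
    then have "\<Lambda> \<noteq> {}"
      using \<Lambda>'(2) by auto
    have "N (x - P \<Lambda> x) / K \<le> sigma_check scale N e f \<Lambda> m x"
      unfolding sigma_check_def
    proof (rule cInf_greatest)
      fix s
      assume "s \<in> {N (x - P I x) | I. I = {} \<or>
            ((\<exists>i j. i \<le> j \<and> I = {i..j}) \<and> (\<forall>a\<in>\<Lambda>. a \<le> Max I) \<and> card I \<le> m)}"
      then consider "s = N (x - P {} x)"
        | i j where "s = N (x - P {i..j} x)" "i \<le> j" "\<forall>a\<in>\<Lambda>. a \<le> Max {i..j}" "card {i..j} \<le> m"
        by auto
      then have "N (x - P \<Lambda> x) \<le> K * s"
      proof cases
        case 1
        have "N (x - P \<Lambda> x) \<le> C * s"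
          unfolding 1 using x \<Lambda>' \<open>\<Lambda> \<noteq> {}\<close> by (intro RPG) auto
        also have "\<dots> \<le> K * s"
          unfolding 1 using \<open>C \<le> K\<close> x by (intro mult_right_mono N_nonneg residual_in_V)
        finally show ?thesis .
      next
        case 2
        note left = greedy_set_left_of_interval[OF \<Lambda>'(1,2) assms(2) m 2(2,4,3)]
        have "1 / (lam - 1) \<le> real k"
          unfolding k_def by linarith
        have "real m = 1 / (lam - 1) * ((lam - 1) * real m)"
          using assms(2) by simp
        also have "\<dots> \<le> real k * real (card (\<Lambda> - {i..j}))"
          using left(2) assms(2) \<open>1 / (lam - 1) \<le> real k\<close> by (intro mult_mono) auto
        finally have "m \<le> k * card (\<Lambda> - {i..j})"
          by (metis of_nat_le_iff of_nat_mult)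
        moreover have "card ({i..j} - \<Lambda>) \<le> card {i..j}"
          by (intro card_mono) auto
        ultimately have "card ({i..j} - \<Lambda>) \<le> k * card (\<Lambda> - {i..j})"
          using 2(4) by linarith
        then show ?thesis
          unfolding K_def 2(1) using left(1,3) RPG x \<Lambda>
          by (intro N_residual_le_blocks) auto
      qed
      then show "N (x - P \<Lambda> x) / K \<le> s"
        using \<open>K \<ge> 1\<close> by (simp add: divide_le_eq mult.commute)
    qed auto
    then show "N (x - P \<Lambda> x) \<le> K * sigma_check scale N e f \<Lambda> m x"
      using \<open>K \<ge> 1\<close> by (simp add: divide_le_eq mult.commute)
  qed
qed

end

section \<open>A null sequence space with summability along the powers of two\<close>

text \<open>The supremum over both indices is the sum of the supremum norm of the sequence and the sum of the
  moduli at the powers of two. Written as one supremum, an upper bound on the norm is a family of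
  inequalities between finitely many coordinates.\<close>

definition pow2_norm :: "(nat \<Rightarrow> 'k::real_normed_field) \<Rightarrow> real" where
  "pow2_norm x = (SUP (k, p). norm (x k) + (\<Sum>i<p. norm (x (2 ^ i))))"

definition pow2_space :: "(nat \<Rightarrow> 'k::real_normed_field) set" where
  "pow2_space = {x. x \<longlonglongrightarrow> 0 \<and> summable (\<lambda>i. norm (x (2 ^ i)))}"

definition pointwise_scale :: "'k::real_normed_field \<Rightarrow> (nat \<Rightarrow> 'k) \<Rightarrow> (nat \<Rightarrow> 'k)" where
  "pointwise_scale c x = (\<lambda>n. c * x n)"

definition unit_seq :: "nat \<Rightarrow> nat \<Rightarrow> 'k::real_normed_field" where
  "unit_seq n = (\<lambda>k. if k = n then 1 else 0)"

definition coord :: "nat \<Rightarrow> (nat \<Rightarrow> 'k) \<Rightarrow> 'k" where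
  "coord n x = x n"

lemma pow2_norm_least:
  assumes "\<And>k p. norm (x k) + (\<Sum>i<p. norm (x (2 ^ i))) \<le> M"
  shows "pow2_norm x \<le> M"
  unfolding pow2_norm_def by (rule cSUP_least) (use assms in auto)

lemma pow2_norm_upper:
  assumes "x \<in> pow2_space"
  shows "norm (x k) + (\<Sum>i<p. norm (x (2 ^ i))) \<le> pow2_norm x"
proof -
  have x: "x \<longlonglongrightarrow> 0" "summable (\<lambda>i. norm (x (2 ^ i)))"
    using assms by (auto simp: pow2_space_def)
  obtain K where K: "\<And>n. norm (x n) \<le> K"
    using x(1) convergent_imp_Bseq[of x] by (auto simp: convergent_def Bseq_def)
  have "norm (x k) + (\<Sum>i<p. norm (x (2 ^ i))) \<le> K + (\<Sum>i. norm (x (2 ^ i)))" for k p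
    using sum_le_suminf[OF x(2), of "{..<p}"] K[of k] by (intro add_mono) auto
  then have "bdd_above (range (\<lambda>(k, p). norm (x k) + (\<Sum>i<p. norm (x (2 ^ i)))))"
    by (intro bdd_aboveI[of _ "K + (\<Sum>i. norm (x (2 ^ i)))"]) auto
  from cSUP_upper[OF UNIV_I this, of "(k, p)"] show ?thesis
    by (simp add: pow2_norm_def)
qed

lemma norm_coord_le: "x \<in> pow2_space \<Longrightarrow> norm (x k) \<le> pow2_norm x"
  using pow2_norm_upper[of x k 0] by simp

lemma finite_support_in_pow2_space:
  fixes x :: "nat \<Rightarrow> 'k::real_normed_field"
  assumes "finite {n. x n \<noteq> 0}"
  shows "x \<in> pow2_space"
proof -
  have "finite {i. x (2 ^ i) \<noteq> 0}"
    by (rule finite_subset[OF _ finite_vimageI[OF assms, of "\<lambda>i. 2 ^ i"]]) (auto simp: inj_def)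
  then have "summable (\<lambda>i. norm (x (2 ^ i)))"
    by (intro summable_finite[of "{i. x (2 ^ i) \<noteq> 0}"]) auto
  moreover have "eventually (\<lambda>n. x n = 0) sequentially"
    using eventually_cofinite[of "\<lambda>n. x n = 0"] assms by (simp add: cofinite_eq_sequentially)
  then have "x \<longlonglongrightarrow> 0"
    by (rule tendsto_eventually)
  ultimately show ?thesis
    by (simp add: pow2_space_def)
qed

lemma pow2_space_add:
  assumes "x \<in> pow2_space" "y \<in> pow2_space"
  shows "x + y \<in> pow2_space"
proof -
  have "summable (\<lambda>i. norm (x (2 ^ i)) + norm (y (2 ^ i)))"
    using assms by (intro summable_add) (auto simp: pow2_space_def)
  then have "summable (\<lambda>i. norm (x (2 ^ i) + y (2 ^ i)))"
    by (rule summable_comparison_test'[where N = 0]) (simp add: norm_triangle_ineq)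
  moreover have "(\<lambda>n. x n + y n) \<longlonglongrightarrow> 0"
    using assms by (intro tendsto_add_zero) (auto simp: pow2_space_def)
  ultimately show ?thesis
    by (simp add: pow2_space_def plus_fun_def)
qed

lemma pow2_space_scale: "x \<in> pow2_space \<Longrightarrow> pointwise_scale c x \<in> pow2_space"
  unfolding pow2_space_def pointwise_scale_def
  by (auto simp: norm_mult intro: tendsto_mult_right_zero summable_mult)

interpretation pointwise: vector_space pointwise_scale
  by unfold_locales (auto simp: pointwise_scale_def plus_fun_def algebra_simps)

lemma pow2_space_subspace: "pointwise.subspace pow2_space"
  by (rule pointwise.subspaceI)
    (auto intro: finite_support_in_pow2_space pow2_space_add pow2_space_scale)

text \<open>A Cauchy sequence converges pointwise. The inequalities whose supremum is the norm each involve
  finitely many coordinates, so they pass to the pointwise limit.\<close>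

lemma pow2_space_complete:
  fixes X :: "nat \<Rightarrow> nat \<Rightarrow> 'k::{real_normed_field,banach}"
  assumes X: "\<And>n. X n \<in> pow2_space"
    and Cauchy: "\<forall>\<epsilon>>0. \<exists>M. \<forall>m\<ge>M. \<forall>n\<ge>M. pow2_norm (X m - X n) < \<epsilon>"
  shows "\<exists>L\<in>pow2_space. (\<lambda>n. pow2_norm (X n - L)) \<longlonglongrightarrow> 0"
proof -
  have diff: "X m - X n \<in> pow2_space" for m n
    using pointwise.subspace_diff[OF pow2_space_subspace X X] .
  have "convergent (\<lambda>n. X n k)" for k
    unfolding Cauchy_convergent_iff[symmetric]
  proof (rule metric_CauchyI)
    fix \<epsilon> :: real assume "\<epsilon> > 0"
    with Cauchy obtain M where "\<forall>m\<ge>M. \<forall>n\<ge>M. pow2_norm (X m - X n) < \<epsilon>"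
      by blast
    moreover have "dist (X m k) (X n k) \<le> pow2_norm (X m - X n)" for m n
      using norm_coord_le[OF diff, of m n k] by (simp add: dist_norm)
    ultimately show "\<exists>M. \<forall>m\<ge>M. \<forall>n\<ge>M. dist (X m k) (X n k) < \<epsilon>"
      by (meson le_less_trans)
  qed
  then obtain L where L: "\<And>k. (\<lambda>n. X n k) \<longlonglongrightarrow> L k"
    unfolding convergent_def by metis
  have tail: "\<exists>M. \<forall>m\<ge>M. \<forall>k p. norm ((X m - L) k) + (\<Sum>i<p. norm ((X m - L) (2 ^ i))) \<le> \<epsilon>"
    if "\<epsilon> > 0" for \<epsilon>
  proof -
    obtain M where M: "\<forall>m\<ge>M. \<forall>n\<ge>M. pow2_norm (X m - X n) < \<epsilon>"
      using Cauchy \<open>\<epsilon> > 0\<close> by blast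
    have "norm ((X m - L) k) + (\<Sum>i<p. norm ((X m - L) (2 ^ i))) \<le> \<epsilon>" if "m \<ge> M" for m k p
    proof (rule Lim_bounded[where M = M])
      show "(\<lambda>n. norm ((X m - X n) k) + (\<Sum>i<p. norm ((X m - X n) (2 ^ i))))
          \<longlonglongrightarrow> norm ((X m - L) k) + (\<Sum>i<p. norm ((X m - L) (2 ^ i)))"
        unfolding fun_diff_def by (intro tendsto_intros L)
      show "\<forall>n\<ge>M. norm ((X m - X n) k) + (\<Sum>i<p. norm ((X m - X n) (2 ^ i))) \<le> \<epsilon>"
        using M that pow2_norm_upper[OF diff, of m _ k p] by (meson less_imp_le order_trans)
    qed
    then show ?thesis
      by blast
  qed
  have "L \<longlonglongrightarrow> 0"
  proof (rule LIMSEQ_I)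
    fix \<epsilon> :: real assume "\<epsilon> > 0"
    then obtain M where M: "\<forall>m\<ge>M. \<forall>k p. norm ((X m - L) k) + (\<Sum>i<p. norm ((X m - L) (2 ^ i))) \<le> \<epsilon> / 2"
      using tail[of "\<epsilon> / 2"] by auto
    have "X M \<longlonglongrightarrow> 0"
      using X by (simp add: pow2_space_def)
    then obtain n0 where n0: "\<forall>n\<ge>n0. norm (X M n) < \<epsilon> / 2"
      using LIMSEQ_D[of "X M" 0 "\<epsilon> / 2"] \<open>\<epsilon> > 0\<close> by auto
    have "norm (L n) < \<epsilon>" if "n \<ge> n0" for n
    proof -
      have "norm (X M n - L n) \<le> \<epsilon> / 2"
        using M[rule_format, of M n 0] by (simp add: fun_diff_def)
      then show ?thesis
        using n0 that norm_triangle_ineq4[of "X M n" "X M n - L n"] by fastforce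
    qed
    then show "\<exists>n0. \<forall>n\<ge>n0. norm (L n - 0) < \<epsilon>"
      by auto
  qed
  moreover have "summable (\<lambda>i. norm (L (2 ^ i)))"
  proof -
    obtain M where M: "\<forall>m\<ge>M. \<forall>k p. norm ((X m - L) k) + (\<Sum>i<p. norm ((X m - L) (2 ^ i))) \<le> 1"
      using tail[of 1] by auto
    have "(\<Sum>i<p. norm (X M (2 ^ i) - L (2 ^ i))) \<le> 1" for p
      using M[rule_format, of M 0 p] norm_ge_zero[of "(X M - L) 0"] unfolding fun_diff_def by linarith
    then have "summable (\<lambda>i. norm (X M (2 ^ i) - L (2 ^ i)))"
      by (intro summableI_nonneg_bounded[where x = 1]) auto
    moreover have "summable (\<lambda>i. norm (X M (2 ^ i)))"
      using X by (simp add: pow2_space_def)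
    ultimately have "summable (\<lambda>i. norm (X M (2 ^ i)) + norm (X M (2 ^ i) - L (2 ^ i)))"
      by (intro summable_add)
    then show ?thesis
    proof (rule summable_comparison_test'[where N = 0])
      fix i :: nat
      show "norm (norm (L (2 ^ i))) \<le> norm (X M (2 ^ i)) + norm (X M (2 ^ i) - L (2 ^ i))"
        using norm_triangle_ineq4[of "X M (2 ^ i)" "X M (2 ^ i) - L (2 ^ i)"] by simp
    qed
  qed
  ultimately have LV: "L \<in> pow2_space"
    by (simp add: pow2_space_def)
  have "(\<lambda>n. pow2_norm (X n - L)) \<longlonglongrightarrow> 0"
  proof (rule LIMSEQ_I)
    fix \<epsilon> :: real assume "\<epsilon> > 0"
    then obtain M where M: "\<forall>m\<ge>M. \<forall>k p. norm ((X m - L) k) + (\<Sum>i<p. norm ((X m - L) (2 ^ i))) \<le> \<epsilon> / 2"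
      using tail[of "\<epsilon> / 2"] by auto
    have "norm (pow2_norm (X m - L) - 0) < \<epsilon>" if "m \<ge> M" for m
    proof -
      have "pow2_norm (X m - L) \<le> \<epsilon> / 2"
        using M that by (intro pow2_norm_least) auto
      moreover have "0 \<le> pow2_norm (X m - L)"
        using norm_coord_le[OF pointwise.subspace_diff[OF pow2_space_subspace X LV], of m 0]
        by (meson norm_ge_zero order_trans)
      ultimately show ?thesis
        using \<open>\<epsilon> > 0\<close> by simp
    qed
    then show "\<exists>M. \<forall>m\<ge>M. norm (pow2_norm (X m - L) - 0) < \<epsilon>"
      by blast
  qed
  with LV show ?thesis
    by blast
qed

lemma pow2_norm_scale_le:
  assumes "x \<in> pow2_space"
  shows "pow2_norm (pointwise_scale c x) \<le> norm c * pow2_norm x"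
proof (rule pow2_norm_least)
  fix k p
  have "norm (pointwise_scale c x k) + (\<Sum>i<p. norm (pointwise_scale c x (2 ^ i)))
      = norm c * (norm (x k) + (\<Sum>i<p. norm (x (2 ^ i))))"
    by (simp add: pointwise_scale_def norm_mult sum_distrib_left distrib_left)
  also have "\<dots> \<le> norm c * pow2_norm x"
    by (intro mult_left_mono pow2_norm_upper assms norm_ge_zero)
  finally show "norm (pointwise_scale c x k) + (\<Sum>i<p. norm (pointwise_scale c x (2 ^ i)))
      \<le> norm c * pow2_norm x" .
qed

lemma pow2_norm_scale:
  assumes "x \<in> pow2_space"
  shows "pow2_norm (pointwise_scale c x) = norm c * pow2_norm x"
proof (cases "c = 0")
  case True
  have "pow2_norm x \<ge> 0" "pow2_norm (pointwise_scale c x) \<ge> 0"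
    using norm_coord_le[of _ 0] assms pow2_space_scale by (meson norm_ge_zero order_trans)+
  then show ?thesis
    using pow2_norm_scale_le[OF assms, of c] True by simp
next
  case False
  then have "pow2_norm x \<le> pow2_norm (pointwise_scale c x) / norm c"
    using pow2_norm_scale_le[OF pow2_space_scale[OF assms], of "inverse c" c]
    by (simp add: norm_inverse divide_inverse mult.commute)
  then show ?thesis
    using pow2_norm_scale_le[OF assms, of c] False by (simp add: le_divide_eq mult.commute)
qed

lemma banach_space_on_pow2_space:
  "banach_space_on pointwise_scale (pow2_space :: (nat \<Rightarrow> 'k::{real_normed_field,banach}) set) pow2_norm"
proof unfold_locales
  show "pointwise.subspace (pow2_space :: (nat \<Rightarrow> 'k) set)"
    by (rule pow2_space_subspace)
next
  fix x :: "nat \<Rightarrow> 'k" assume x: "x \<in> pow2_space"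
  show "pow2_norm x = 0 \<longleftrightarrow> x = 0"
  proof
    assume "pow2_norm x = 0"
    then show "x = 0"
      using norm_coord_le[OF x] by (auto simp: fun_eq_iff)
  next
    assume "x = 0"
    then have "pow2_norm x \<le> 0"
      by (intro pow2_norm_least) auto
    then show "pow2_norm x = 0"
      using norm_coord_le[OF x, of 0] norm_ge_zero[of "x 0"] by linarith
  qed
next
  fix x y :: "nat \<Rightarrow> 'k" assume xy: "x \<in> pow2_space" "y \<in> pow2_space"
  show "pow2_norm (x + y) \<le> pow2_norm x + pow2_norm y"
  proof (rule pow2_norm_least)
    fix k p
    have "norm ((x + y) k) + (\<Sum>i<p. norm ((x + y) (2 ^ i)))
        \<le> (norm (x k) + norm (y k)) + (\<Sum>i<p. norm (x (2 ^ i)) + norm (y (2 ^ i)))"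
      by (intro add_mono sum_mono) (auto intro: norm_triangle_ineq)
    also have "\<dots> \<le> pow2_norm x + pow2_norm y"
      using pow2_norm_upper[OF xy(1), of k p] pow2_norm_upper[OF xy(2), of k p]
      by (simp add: sum.distrib)
    finally show "norm ((x + y) k) + (\<Sum>i<p. norm ((x + y) (2 ^ i))) \<le> pow2_norm x + pow2_norm y" .
  qed
qed (auto intro: pow2_norm_scale pow2_space_complete)

section \<open>The unit sequences form an unconditional basis\<close>

lemma residual_coord:
  assumes "finite A"
  shows "(x - proj pointwise_scale unit_seq coord A x) n = (if n \<in> A then 0 else x n)"
proof -
  have "proj pointwise_scale unit_seq coord A x n = (\<Sum>k\<in>A. if k = n then x n else 0)"
    using assms unfolding proj_def
    by (induction A rule: finite_induct) (auto simp: pointwise_scale_def unit_seq_def coord_def)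
  then show ?thesis
    using assms by (simp add: fun_diff_def)
qed

lemma residual_in_pow2_space:
  assumes "x \<in> pow2_space" "finite A"
  shows "x - proj pointwise_scale unit_seq coord A x \<in> pow2_space"
proof -
  have "proj pointwise_scale unit_seq coord A x n = 0" if "n \<notin> A" for n
    using residual_coord[OF assms(2), of x n] that by simp
  then have "finite {n. proj pointwise_scale unit_seq coord A x n \<noteq> 0}"
    by (intro finite_subset[OF _ assms(2)]) auto
  then show ?thesis
    by (intro pointwise.subspace_diff[OF pow2_space_subspace] assms finite_support_in_pow2_space)
qed

lemma infinite_dimensional_pow2_space:
  "infinite_dimensional pointwise_scale (pow2_space :: (nat \<Rightarrow> 'k::real_normed_field) set)"
  unfolding infinite_dimensional_def
proof
  let ?E = "range (unit_seq :: nat \<Rightarrow> nat \<Rightarrow> 'k)"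
  have inj: "inj (unit_seq :: nat \<Rightarrow> nat \<Rightarrow> 'k)"
    by (auto simp: inj_def unit_seq_def fun_eq_iff split: if_splits)
  have indep: "pointwise.independent ?E"
  proof
    assume "pointwise.dependent ?E"
    then obtain t u v where t: "finite t" "t \<subseteq> ?E" "(\<Sum>v\<in>t. pointwise_scale (u v) v) = 0"
        "v \<in> t" "u v \<noteq> 0"
      unfolding pointwise.dependent_explicit by blast
    obtain n where n: "v = unit_seq n"
      using t by auto
    have "(\<Sum>v\<in>s. pointwise_scale (u v) v) n = (\<Sum>v\<in>s. u v * v n)" if "finite s" for s
      using that by (induction s rule: finite_induct) (auto simp: pointwise_scale_def)
    from this[OF t(1)] have "0 = (\<Sum>w\<in>t. u w * w n)"
      unfolding t(3) by simp
    also have "\<dots> = (\<Sum>w\<in>t. if w = v then u v else 0)"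
    proof (intro sum.cong refl)
      fix w assume "w \<in> t"
      then obtain k where "w = unit_seq k"
        using t(2) by auto
      then show "u w * w n = (if w = v then u v else 0)"
        unfolding n by (cases "k = n") (auto simp: unit_seq_def dest: fun_cong[of _ _ n])
    qed
    also have "\<dots> = u v"
      using t by simp
    finally show False
      using t by simp
  qed
  assume "\<exists>B. finite B \<and> B \<subseteq> pow2_space \<and> (pow2_space :: (nat \<Rightarrow> 'k) set) \<subseteq> pointwise.span B"
  then obtain B where B: "finite B" "(pow2_space :: (nat \<Rightarrow> 'k) set) \<subseteq> pointwise.span B"
    by blast
  have "?E \<subseteq> pow2_space"
    by (auto simp: unit_seq_def intro!: finite_support_in_pow2_space)
  then have "finite ?E"
    using pointwise.independent_span_bound[OF B(1) indep] B(2) by auto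
  then show False
    using inj finite_imageD by blast
qed

text \<open>Removing any set of coordinates that contains \<open>{..<2 ^ M}\<close> removes both the first \<open>M\<close>
  coordinates and the first \<open>M\<close> powers of two, so what remains is small in both parts of the norm,
  whatever the order in which the coordinates were exhausted.\<close>

lemma unconditional_pow2_space:
  "unconditional pointwise_scale (pow2_space :: (nat \<Rightarrow> 'k::real_normed_field) set) pow2_norm
     unit_seq coord"
  unfolding unconditional_def
proof (intro ballI allI impI LIMSEQ_I)
  fix x :: "nat \<Rightarrow> 'k" and \<pi> :: "nat \<Rightarrow> nat" and \<epsilon> :: real
  assume x: "x \<in> pow2_space" and \<pi>: "bij \<pi>" and "\<epsilon> > 0"
  have "x \<longlonglongrightarrow> 0" and summable: "summable (\<lambda>i. norm (x (2 ^ i)))"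
    using x by (auto simp: pow2_space_def)
  then obtain M1 where M1: "\<And>n. n \<ge> M1 \<Longrightarrow> norm (x n) < \<epsilon> / 3"
    using LIMSEQ_D[of x 0 "\<epsilon> / 3"] \<open>\<epsilon> > 0\<close> by auto
  obtain M2 where M2: "\<And>m n. m \<ge> M2 \<Longrightarrow> norm (sum (\<lambda>i. norm (x (2 ^ i))) {m..<n}) < \<epsilon> / 3"
    using summable \<open>\<epsilon> > 0\<close> unfolding summable_Cauchy by (metis zero_less_divide_iff zero_less_numeral)
  define M where "M = max M1 M2"
  have tail: "pow2_norm (x - proj pointwise_scale unit_seq coord A x) < \<epsilon>"
    if A: "finite A" "{..<2 ^ M} \<subseteq> A" for A
  proof -
    let ?y = "x - proj pointwise_scale unit_seq coord A x"
    have y: "?y n = (if n \<in> A then 0 else x n)" for n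
      by (rule residual_coord[OF A(1)])
    have "pow2_norm ?y \<le> \<epsilon> / 3 + \<epsilon> / 3"
    proof (intro pow2_norm_least add_mono)
      fix k
      show "norm (?y k) \<le> \<epsilon> / 3"
      proof (cases "k \<in> A")
        case False
        then have "2 ^ M \<le> k"
          using A(2) by (auto simp: subset_iff not_less)
        then have "M1 \<le> k"
          using less_exp[of M] unfolding M_def by linarith
        then show ?thesis
          using M1[of k] False by (simp add: y del: minus_apply)
      qed (use \<open>\<epsilon> > 0\<close> in \<open>simp add: y del: minus_apply\<close>)
    next
      fix p
      have "(\<Sum>i<p. norm (?y (2 ^ i))) \<le> (\<Sum>i<p. if i \<in> {M..<p} then norm (x (2 ^ i)) else 0)"
      proof (rule sum_mono)
        fix i assume "i \<in> {..<p}"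
        show "norm (?y (2 ^ i)) \<le> (if i \<in> {M..<p} then norm (x (2 ^ i)) else 0)"
        proof (cases "i < M")
          case True
          then have "2 ^ i \<in> A"
            using A(2) by auto
          then show ?thesis
            by (simp add: y del: minus_apply)
        qed (use \<open>i \<in> {..<p}\<close> in \<open>simp add: y del: minus_apply\<close>)
      qed
      also have "\<dots> = (\<Sum>i\<in>{M..<p}. norm (x (2 ^ i)))"
        by (intro sum.mono_neutral_cong_right) auto
      also have "\<dots> \<le> \<epsilon> / 3"
        using M2[of M p] by (simp add: M_def)
      finally show "(\<Sum>i<p. norm (?y (2 ^ i))) \<le> \<epsilon> / 3" .
    qed
    then show ?thesis
      using \<open>\<epsilon> > 0\<close> by simp
  qed
  define n0 where "n0 = Suc (Max (inv \<pi> ` {..<2 ^ M}))"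
  show "\<exists>n0. \<forall>n\<ge>n0. norm (pow2_norm (x -
      (\<Sum>k<n. pointwise_scale (coord (\<pi> k) x) (unit_seq (\<pi> k)))) - 0) < \<epsilon>"
  proof (intro exI allI impI)
    fix n assume "n \<ge> n0"
    have "j \<in> \<pi> ` {..<n}" if "j < 2 ^ M" for j
    proof -
      have "inv \<pi> j \<le> Max (inv \<pi> ` {..<2 ^ M})"
        using that by (intro Max_ge) auto
      then have "inv \<pi> j < n"
        using \<open>n \<ge> n0\<close> by (simp add: n0_def)
      moreover have "j = \<pi> (inv \<pi> j)"
        using \<pi> by (simp add: bij_is_surj surj_f_inv_f)
      ultimately show ?thesis
        by blast
    qed
    then have A: "finite (\<pi> ` {..<n})" "{..<2 ^ M} \<subseteq> \<pi> ` {..<n}"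
      by auto
    have eq: "(\<Sum>k<n. pointwise_scale (coord (\<pi> k) x) (unit_seq (\<pi> k)))
        = proj pointwise_scale unit_seq coord (\<pi> ` {..<n}) x"
      unfolding proj_def using \<pi>
      by (simp add: sum.reindex inj_on_subset[OF bij_is_inj] o_def)
    have "0 \<le> pow2_norm (x - proj pointwise_scale unit_seq coord (\<pi> ` {..<n}) x)"
      using norm_coord_le[OF residual_in_pow2_space[OF x A(1)], of 0]
      by (meson norm_ge_zero order_trans)
    then show "norm (pow2_norm (x -
        (\<Sum>k<n. pointwise_scale (coord (\<pi> k) x) (unit_seq (\<pi> k)))) - 0) < \<epsilon>"
      unfolding eq using tail[OF A] by simp
  qed
qed

lemma pow2_norm_unit_seq:
  "1 \<le> pow2_norm (unit_seq n :: nat \<Rightarrow> 'k::real_normed_field)"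
  "pow2_norm (unit_seq n :: nat \<Rightarrow> 'k) \<le> 2"
proof -
  let ?u = "unit_seq n :: nat \<Rightarrow> 'k"
  have mem: "?u \<in> pow2_space"
    by (auto simp: unit_seq_def intro!: finite_support_in_pow2_space)
  show "1 \<le> pow2_norm ?u"
    using norm_coord_le[OF mem, of n] by (simp add: unit_seq_def)
  show "pow2_norm ?u \<le> 2"
  proof (rule pow2_norm_least)
    fix k p
    have "(\<Sum>i<p. norm (?u (2 ^ i))) = real (card {i \<in> {..<p}. 2 ^ i = n})"
      by (simp add: unit_seq_def if_distrib sum.If_cases Int_def cong: if_cong)
    also have "card {i \<in> {..<p}. 2 ^ i = n} \<le> 1"
      by (auto simp: card_le_Suc0_iff_eq)
    finally have "(\<Sum>i<p. norm (?u (2 ^ i))) \<le> 1"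
      by simp
    moreover have "norm (?u k) \<le> 1"
      by (simp add: unit_seq_def)
    ultimately show "norm (?u k) + (\<Sum>i<p. norm (?u (2 ^ i))) \<le> 2"
      by simp
  qed
qed

lemma dual_norm_coord:
  "1 / 2 \<le> dual_norm pow2_space pow2_norm (coord n :: (nat \<Rightarrow> 'k) \<Rightarrow> 'k::real_normed_field)"
  "dual_norm pow2_space pow2_norm (coord n :: (nat \<Rightarrow> 'k) \<Rightarrow> 'k) \<le> 1"
proof -
  let ?ball = "{x \<in> pow2_space. pow2_norm x \<le> 1} :: (nat \<Rightarrow> 'k) set"
  have le: "norm (coord n x) \<le> 1" if "x \<in> ?ball" for x
    using that norm_coord_le[of x n] by (simp add: coord_def)
  (* Unit sequences at powers of two have norm 2, hence the factor that puts h in the ball. *)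
  define h :: "nat \<Rightarrow> 'k" where "h = pointwise_scale (of_real (1 / 2)) (unit_seq n)"
  have mem: "unit_seq n \<in> (pow2_space :: (nat \<Rightarrow> 'k) set)"
    by (auto simp: unit_seq_def intro!: finite_support_in_pow2_space)
  have "pow2_norm h = 1 / 2 * pow2_norm (unit_seq n :: nat \<Rightarrow> 'k)"
    unfolding h_def by (subst pow2_norm_scale[OF mem]) (simp add: norm_divide)
  then have h: "h \<in> ?ball"
    using pow2_space_scale[OF mem] pow2_norm_unit_seq(2)[where 'k = 'k, of n] by (simp add: h_def)
  have "norm (coord n h) = 1 / 2"
    by (simp add: h_def pointwise_scale_def unit_seq_def coord_def norm_divide)
  then show "1 / 2 \<le> dual_norm pow2_space pow2_norm (coord n :: (nat \<Rightarrow> 'k) \<Rightarrow> 'k)"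
    unfolding dual_norm_def using cSUP_upper[OF h, of "\<lambda>x. norm (coord n x)"] le
    by (force simp: bdd_above_def)
  show "dual_norm pow2_space pow2_norm (coord n :: (nat \<Rightarrow> 'k) \<Rightarrow> 'k) \<le> 1"
    unfolding dual_norm_def using h le by (intro cSUP_least) auto
qed

lemma is_basis_pow2_space:
  "is_basis pointwise_scale (pow2_space :: (nat \<Rightarrow> 'k::real_normed_field) set) pow2_norm unit_seq coord"
  unfolding is_basis_def
proof (intro conjI allI ballI impI)
  show "unit_seq n \<in> (pow2_space :: (nat \<Rightarrow> 'k) set)" for n
    by (auto simp: unit_seq_def intro!: finite_support_in_pow2_space)
next
  fix x :: "nat \<Rightarrow> 'k" and \<epsilon> :: real assume "x \<in> pow2_space" "\<epsilon> > 0"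
  then have "(\<lambda>n. pow2_norm (x - (\<Sum>k<n. pointwise_scale (coord k x) (unit_seq k)))) \<longlonglongrightarrow> 0"
    using unconditional_pow2_space[unfolded unconditional_def, rule_format, of x "\<lambda>k. k"]
    by (simp add: bij_def)
  then obtain n where "norm (pow2_norm (x - (\<Sum>k<n. pointwise_scale (coord k x) (unit_seq k))) - 0) < \<epsilon>"
    using LIMSEQ_D \<open>\<epsilon> > 0\<close> by blast
  moreover have "(\<Sum>k<n. pointwise_scale (coord k x) (unit_seq k))
      \<in> pointwise.span (range (unit_seq :: nat \<Rightarrow> nat \<Rightarrow> 'k))"
    by (intro pointwise.span_sum pointwise.span_scale pointwise.span_base) auto
  ultimately show "\<exists>y\<in>pointwise.span (range unit_seq). pow2_norm (x - y) < \<epsilon>"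
    by force
next
  show "bounded_functional pointwise_scale pow2_space pow2_norm (coord n :: (nat \<Rightarrow> 'k) \<Rightarrow> 'k)" for n
    unfolding bounded_functional_def
    by (auto simp: coord_def pointwise_scale_def intro!: exI[of _ 1] norm_coord_le)
next
  show "(coord n (unit_seq m) :: 'k) = (if n = m then 1 else 0)" for n m
    by (simp add: coord_def unit_seq_def)
next
  show "\<exists>c1 c2. c1 > 0 \<and> c2 > 0 \<and>
        (\<forall>n. c1 \<le> pow2_norm (unit_seq n :: nat \<Rightarrow> 'k) \<and> pow2_norm (unit_seq n :: nat \<Rightarrow> 'k) \<le> c2 \<and>
          c1 \<le> dual_norm pow2_space pow2_norm (coord n :: (nat \<Rightarrow> 'k) \<Rightarrow> 'k) \<and>
          dual_norm pow2_space pow2_norm (coord n :: (nat \<Rightarrow> 'k) \<Rightarrow> 'k) \<le> c2)"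
  proof (rule exI[of _ "1 / 2"], rule exI[of _ 2], intro conjI allI)
    fix n
    show "1 / 2 \<le> pow2_norm (unit_seq n :: nat \<Rightarrow> 'k)" "pow2_norm (unit_seq n :: nat \<Rightarrow> 'k) \<le> 2"
      "1 / 2 \<le> dual_norm pow2_space pow2_norm (coord n :: (nat \<Rightarrow> 'k) \<Rightarrow> 'k)"
      "dual_norm pow2_space pow2_norm (coord n :: (nat \<Rightarrow> 'k) \<Rightarrow> 'k) \<le> 2"
      using pow2_norm_unit_seq[where 'k = 'k, of n] dual_norm_coord[where 'k = 'k, of n] by linarith+
  qed auto
qed

section \<open>Short intervals cannot see the powers of two\<close>

text \<open>Exponents of powers of two within a factor \<open>2 ^ K\<close> of each other differ by less than \<open>K\<close>.\<close>

lemma card_pow2_exponents_le: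
  assumes "i > 0" "j < 2 ^ K * i"
  shows "finite {q. 2 ^ q \<in> {i..j}}" "card {q. 2 ^ q \<in> {i..j::nat}} \<le> K"
proof -
  let ?Q = "{q. 2 ^ q \<in> {i..j::nat}}"
  have "?Q \<subseteq> {a..<a + K}" if "2 ^ a \<in> {i..j}" "\<forall>q\<in>?Q. a \<le> q" for a
  proof
    fix q assume q: "q \<in> ?Q"
    then have "2 ^ q < 2 ^ K * i"
      using assms(2) by auto
    also have "\<dots> \<le> 2 ^ K * 2 ^ a"
      using that by simp
    also have "\<dots> = 2 ^ (a + K)"
      by (simp add: power_add)
    finally show "q \<in> {a..<a + K}"
      using that q by (auto dest: power_less_imp_less_exp)
  qed
  moreover have "?Q = {} \<or> (\<exists>a. 2 ^ a \<in> {i..j} \<and> (\<forall>q\<in>?Q. a \<le> q))"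
    using exists_least_iff[of "\<lambda>q. 2 ^ q \<in> {i..j}"] by (auto simp: not_less) (meson leI)
  ultimately obtain a where "?Q \<subseteq> {a..<a + K}"
    by blast
  then show "finite ?Q" "card ?Q \<le> K"
    using finite_subset card_mono[of "{a..<a + K}" ?Q] by auto
qed

text \<open>A greedy set \<open>\<Lambda>\<close> ending no later than the interval \<open>I\<close> has at least \<open>(lam - 1) * m\<close> elements to the
  left of \<open>I\<close>. This pushes \<open>I\<close> so far to the right, relative to its length, that it contains only a
  bounded number \<open>K\<close> of powers of two. The coordinates in \<open>I - \<Lambda>\<close> are bounded by any coordinate
  \<open>t\<close> of \<open>\<Lambda> - I\<close>, which survives in \<open>x - P I x\<close>; so restoring them costs at most \<open>(1 + K) * t\<close>.\<close>

lemma RPG2_pow2_space: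
  assumes "lam > 1"
  shows "RPG2 lam pointwise_scale (pow2_space :: (nat \<Rightarrow> 'k::real_normed_field) set) pow2_norm unit_seq coord"
proof -
  obtain K where K: "1 / (lam - 1) + 1 < 2 ^ K"
    using real_arch_pow[of 2 "1 / (lam - 1) + 1"] by auto
  show ?thesis
    unfolding RPG2_def
  proof (intro exI conjI ballI allI impI)
    show "1 \<le> real K + 2"
      by simp
    fix x :: "nat \<Rightarrow> 'k" and m \<Lambda>
    assume x: "x \<in> pow2_space" and m: "1 \<le> m" and \<Lambda>: "\<Lambda> \<in> greedy_sets coord x (nat \<lceil>lam * real m\<rceil>)"
    have \<Lambda>': "finite \<Lambda>" "card \<Lambda> = nat \<lceil>lam * real m\<rceil>"
      and greedy: "\<And>n k. n \<in> \<Lambda> \<Longrightarrow> k \<notin> \<Lambda> \<Longrightarrow> norm (x k) \<le> norm (x n)"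
      using \<Lambda> by (auto simp: greedy_sets_def coord_def)
    let ?R = "\<lambda>A. x - proj pointwise_scale unit_seq coord A x"
    have R: "?R A n = (if n \<in> A then 0 else x n)" if "finite A" for A n
      using residual_coord[OF that] .
    have "pow2_norm (?R \<Lambda>) / (real K + 2) \<le> sigma_check pointwise_scale pow2_norm unit_seq coord \<Lambda> m x"
      unfolding sigma_check_def
    proof (rule cInf_greatest)
      fix s
      assume "s \<in> {pow2_norm (?R I) | I. I = {} \<or>
            ((\<exists>i j. i \<le> j \<and> I = {i..j}) \<and> (\<forall>a\<in>\<Lambda>. a \<le> Max I) \<and> card I \<le> m)}"
      then consider "s = pow2_norm (?R {})"
        | i j where "s = pow2_norm (?R {i..j})" "i \<le> j" "\<forall>a\<in>\<Lambda>. a \<le> Max {i..j}" "card {i..j} \<le> m"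
        by auto
      then have "pow2_norm (?R \<Lambda>) \<le> (real K + 2) * s"
      proof cases
        case 1
        have s: "s = pow2_norm x"
          using 1 by (simp add: proj_def)
        have "pow2_norm (?R \<Lambda>) \<le> pow2_norm x"
        proof (rule pow2_norm_least)
          fix k p
          have "norm (?R \<Lambda> k) + (\<Sum>i<p. norm (?R \<Lambda> (2 ^ i))) \<le> norm (x k) + (\<Sum>i<p. norm (x (2 ^ i)))"
            by (intro add_mono sum_mono) (auto simp: R[OF \<Lambda>'(1)] simp del: minus_apply)
          also have "\<dots> \<le> pow2_norm x"
            by (rule pow2_norm_upper[OF x])
          finally show "norm (?R \<Lambda> k) + (\<Sum>i<p. norm (?R \<Lambda> (2 ^ i))) \<le> pow2_norm x" .
        qed
        moreover have "0 \<le> pow2_norm x"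
          using norm_coord_le[OF x, of 0] by (meson norm_ge_zero order_trans)
        ultimately show ?thesis
          by (simp add: s distrib_right mult_nonneg_nonneg add_increasing)
      next
        case 2
        note left = greedy_set_left_of_interval[OF \<Lambda>' assms m 2(2,4,3)]
        let ?I = "{i..j}"
        let ?y = "?R ?I"
        have y: "?y \<in> pow2_space"
          by (rule residual_in_pow2_space[OF x]) simp
        obtain b where b: "b \<in> \<Lambda>" "b \<notin> ?I"
          using left(3) by blast
        define t where "t = norm (x b)"
        have t: "t \<le> s"
          unfolding 2(1) t_def using norm_coord_le[OF y, of b] R[of ?I b] b(2) by (metis finite_atLeastAtMost)
        have pointwise: "norm (?R \<Lambda> n) \<le> norm (?y n) + (if n \<in> ?I then t else 0)" for n
          using greedy[OF b(1), of n] by (auto simp: R \<Lambda>'(1) t_def simp del: minus_apply)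
        have "(lam - 1) * real m \<le> real i"
          using left(2) card_mono[OF finite_lessThan left(1)] by simp
        then have "real m \<le> 1 / (lam - 1) * real i"
          using assms by (simp add: field_simps)
        moreover have "0 < (lam - 1) * real m"
          using assms m by simp
        then have "i > 0"
          using \<open>(lam - 1) * real m \<le> real i\<close> by linarith
        moreover have "j < i + m"
          using 2(2,4) by simp
        ultimately have "real j < (1 / (lam - 1) + 1) * real i"
          by (simp add: algebra_simps)
        also have "\<dots> < 2 ^ K * real i"
          using K \<open>i > 0\<close> by simp
        finally have "j < 2 ^ K * i"
          by (metis of_nat_less_iff of_nat_mult of_nat_numeral of_nat_power)
        note Q = card_pow2_exponents_le[OF \<open>i > 0\<close> this]
        have "pow2_norm (?R \<Lambda>) \<le> s + (1 + real K) * t"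
        proof (rule pow2_norm_least)
          fix k p
          have "(\<Sum>q<p. if 2 ^ q \<in> ?I then t else 0) \<le> real K * t"
          proof -
            have "(\<Sum>q<p. if 2 ^ q \<in> ?I then t else 0) = real (card ({..<p} \<inter> {q. 2 ^ q \<in> ?I})) * t"
              by (simp add: sum.If_cases)
            also have "\<dots> \<le> real K * t"
              using Q card_mono[OF Q(1), of "{..<p} \<inter> {q. 2 ^ q \<in> ?I}"]
              by (intro mult_right_mono) (auto simp: t_def)
            finally show ?thesis .
          qed
          moreover have "(\<Sum>q<p. norm (?R \<Lambda> (2 ^ q)))
              \<le> (\<Sum>q<p. norm (?y (2 ^ q))) + (\<Sum>q<p. if 2 ^ q \<in> ?I then t else 0)"
            unfolding sum.distrib[symmetric] by (intro sum_mono pointwise)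
          moreover have "norm (?R \<Lambda> k) \<le> norm (?y k) + t"
            using pointwise[of k] by (auto simp: t_def split: if_splits intro: order_trans)
          moreover have "norm (?y k) + (\<Sum>q<p. norm (?y (2 ^ q))) \<le> s"
            unfolding 2(1) by (rule pow2_norm_upper[OF y])
          ultimately show "norm (?R \<Lambda> k) + (\<Sum>q<p. norm (?R \<Lambda> (2 ^ q))) \<le> s + (1 + real K) * t"
            by (simp add: algebra_simps del: minus_apply)
        qed
        also have "\<dots> \<le> s + (1 + real K) * s"
          using t by (intro add_left_mono mult_left_mono) auto
        finally show ?thesis
          by (simp add: algebra_simps)
      qed
      then show "pow2_norm (?R \<Lambda>) / (real K + 2) \<le> s"
        by (simp add: divide_le_eq mult.commute)
    qed auto
    then show "pow2_norm (?R \<Lambda>) \<le> (real K + 2) * sigma_check pointwise_scale pow2_norm unit_seq coord \<Lambda> m x"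
      by (simp add: divide_le_eq mult.commute)
  qed
qed

text \<open>The sets admitted in the definition of RPG need not be intervals: here \<open>A\<close> consists of \<open>k\<close> powers
  of two and \<open>B\<close> of \<open>k\<close> numbers to its left that are not powers of two. The indicator sequence of
  \<open>A\<close> has norm \<open>k + 1\<close>, that of \<open>B\<close> has norm one.\<close>

lemma not_RPG_pow2_space:
  "\<not> RPG pointwise_scale (pow2_space :: (nat \<Rightarrow> 'k::real_normed_field) set) pow2_norm unit_seq coord"
proof
  assume "RPG pointwise_scale (pow2_space :: (nat \<Rightarrow> 'k) set) pow2_norm unit_seq coord"
  then obtain C where C: "C \<ge> 1" "\<And>(x :: nat \<Rightarrow> 'k) m \<Lambda>. x \<in> pow2_space \<Longrightarrow> m \<ge> 1 \<Longrightarrow>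
      \<Lambda> \<in> greedy_sets coord x m \<Longrightarrow>
      pow2_norm (x - proj pointwise_scale unit_seq coord \<Lambda> x) \<le>
      C * Inf {pow2_norm (x - proj pointwise_scale unit_seq coord A x) | A.
         finite A \<and> card A \<le> m \<and> (\<forall>a\<in>A. \<forall>b\<in>\<Lambda>. a > b)}"
    unfolding RPG_def by blast
  obtain k :: nat where k: "real k > C"
    using reals_Archimedean2 by blast
  then have "k \<ge> 1"
    using C(1) by (cases k) auto
  (* B fits strictly between two consecutive powers of two because k < 2 ^ k. *)
  define B where "B = {2 ^ k + 1..2 ^ k + k}"
  define A where "A = (\<lambda>q. 2 ^ q :: nat) ` {k + 1..2 * k}"
  define x :: "nat \<Rightarrow> 'k" where "x = (\<lambda>n. if n \<in> A \<union> B then 1 else 0)"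
  have fin: "finite A" "finite B"
    by (auto simp: A_def B_def)
  have card: "card A = k" "card B = k"
    unfolding A_def B_def by (subst card_image) (auto simp: inj_on_def)
  have lt: "2 ^ k + k < (2::nat) ^ (k + 1)"
    using less_exp[of k] by simp
  have B_pow2: "2 ^ q \<notin> B" for q
  proof
    assume "2 ^ q \<in> B"
    then have "2 ^ k + 1 \<le> (2::nat) ^ q" "2 ^ q \<le> 2 ^ k + k"
      unfolding B_def atLeastAtMost_iff by blast+
    then have "(2::nat) ^ k < 2 ^ q" "(2::nat) ^ q < 2 ^ (k + 1)"
      using lt by linarith+
    then have "k < q" "q < k + 1"
      by (auto dest: power_less_imp_less_exp[rotated] simp del: power_Suc)
    then show False
      by simp
  qed
  have BA: "\<forall>a\<in>A. \<forall>b\<in>B. a > b"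
  proof (intro ballI)
    fix a b assume "a \<in> A" "b \<in> B"
    then obtain q where "a = 2 ^ q" "q \<ge> k + 1" "b \<le> 2 ^ k + k"
      by (auto simp: A_def B_def)
    then show "b < a"
      using lt power_increasing[of "k + 1" q "2::nat"] by linarith
  qed
  have x: "x \<in> pow2_space"
    by (rule finite_support_in_pow2_space, rule finite_subset[of _ "A \<union> B"])
      (use fin in \<open>auto simp: x_def\<close>)
  have greedy: "B \<in> greedy_sets coord x k"
    using fin card by (auto simp: greedy_sets_def coord_def x_def)
  let ?R = "\<lambda>A. x - proj pointwise_scale unit_seq coord A x"
  have R: "?R S n = (if n \<in> S then 0 else x n)" if "finite S" for S n
    using residual_coord[OF that] .
  have "real k \<le> norm (?R B 0) + (\<Sum>i<2 * k + 1. norm (?R B (2 ^ i)))"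
  proof -
    have "norm (?R B (2 ^ i)) = 1" if "i \<in> {k + 1..2 * k}" for i
    proof -
      have "2 ^ i \<in> A"
        using that by (auto simp: A_def)
      then have "x (2 ^ i) = 1"
        by (simp add: x_def)
      then show ?thesis
        using B_pow2[of i] by (simp only: R[OF fin(2)]) simp
    qed
    then have "real k = (\<Sum>i\<in>{k + 1..2 * k}. norm (?R B (2 ^ i)))"
      by simp
    also have "\<dots> \<le> (\<Sum>i<2 * k + 1. norm (?R B (2 ^ i)))"
      by (intro sum_mono2) auto
    finally show ?thesis
      by (simp add: add_increasing)
  qed
  also have "\<dots> \<le> pow2_norm (?R B)"
    by (rule pow2_norm_upper[OF residual_in_pow2_space[OF x fin(2)]])
  also have "\<dots> \<le> C * Inf {pow2_norm (?R A) | A.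
         finite A \<and> card A \<le> k \<and> (\<forall>a\<in>A. \<forall>b\<in>B. a > b)}"
    by (rule C(2)[OF x \<open>k \<ge> 1\<close> greedy])
  also have "\<dots> \<le> C * pow2_norm (?R A)"
  proof (intro mult_left_mono cInf_lower bdd_belowI[of _ 0])
    fix s assume "s \<in> {pow2_norm (?R A) | A. finite A \<and> card A \<le> k \<and> (\<forall>a\<in>A. \<forall>b\<in>B. a > b)}"
    then obtain S where S: "finite S" "s = pow2_norm (?R S)"
      by blast
    then show "0 \<le> s"
      using norm_coord_le[OF residual_in_pow2_space[OF x S(1)], of 0]
      by (metis norm_ge_zero order_trans)
  qed (use fin card BA C(1) in auto)
  also have "\<dots> \<le> C * 1"
  proof (intro mult_left_mono pow2_norm_least)
    fix n p
    have "norm (?R A (2 ^ i)) = 0" for i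
      unfolding R[OF fin(1)] using B_pow2 by (simp add: x_def)
    moreover have "norm (?R A n) \<le> 1"
      unfolding R[OF fin(1)] by (simp add: x_def)
    ultimately show "norm (?R A n) + (\<Sum>i<p. norm (?R A (2 ^ i))) \<le> 1"
      by (simp del: minus_apply)
  qed (use C(1) in simp)
  finally show False
    using k by simp
qed

section \<open>The comparison of the two properties\<close>

theorem theorem1p4:
  fixes lam :: real
  assumes "lam > 1"
  shows "(\<forall>(scale :: 'k::{real_normed_field,banach} \<Rightarrow> 'v::ab_group_add \<Rightarrow> 'v) V N e f.
            banach_space_on scale V N \<and> infinite_dimensional scale V \<and>
            is_basis scale V N e f \<and> RPG scale V N e f \<longrightarrow> RPG2 lam scale V N e f)
       \<and> (\<exists>(scale :: 'k \<Rightarrow> (nat \<Rightarrow> 'k) \<Rightarrow> (nat \<Rightarrow> 'k)) V N e f.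
            banach_space_on scale V N \<and> infinite_dimensional scale V \<and>
            is_basis scale V N e f \<and> unconditional scale V N e f \<and>
            RPG2 lam scale V N e f \<and> \<not> RPG scale V N e f)"
proof (rule conjI)
  show "\<forall>(scale :: 'k \<Rightarrow> 'v \<Rightarrow> 'v) V N e f.
            banach_space_on scale V N \<and> infinite_dimensional scale V \<and>
            is_basis scale V N e f \<and> RPG scale V N e f \<longrightarrow> RPG2 lam scale V N e f"
    using banach_basis.RPG_imp_RPG2[OF banach_basis.intro[OF _ banach_basis_axioms.intro]] assms
    by blast
next
  show "\<exists>(scale :: 'k \<Rightarrow> (nat \<Rightarrow> 'k) \<Rightarrow> (nat \<Rightarrow> 'k)) V N e f.
            banach_space_on scale V N \<and> infinite_dimensional scale V \<and>
            is_basis scale V N e f \<and> unconditional scale V N e f \<and>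
            RPG2 lam scale V N e f \<and> \<not> RPG scale V N e f"
    using banach_space_on_pow2_space infinite_dimensional_pow2_space is_basis_pow2_space
      unconditional_pow2_space RPG2_pow2_space[OF assms] not_RPG_pow2_space
    by blast
qed

end
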